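(* Let $d \geq 1$, let $\Sigma$ be a finite state set, let $\mathcal{R}$ be a finite set of local rules with state set $\Sigma$ and a common neighbourhood $N$, and let $\theta \in \mathcal{R}^{\mathbb{Z}^d}$ be a uniformly recurrent rule distribution. Then the global update rule $H_\theta : \Sigma^{\mathbb{Z}^d} \to \Sigma^{\mathbb{Z}^d}$ is surjective if and only if it is pre-injective.
   Context: A neighbourhood is a tuple $N = (\bar n_1,\ldots,\bar n_m)$ of vectors in $\mathbb{Z}^d$. A local rule with state set $\Sigma$ and neighbourhood $N$ is a function $f:\Sigma^m \to \Sigma$. A configuration over a finite set $S$ is a function $c:\mathbb{Z}^d \to S$. A (local) rule distribution is a configuration $\theta \in \mathcal{R}^{\mathbb{Z}^d}$, where $\mathcal{R}$ is a finite set of local rules with the same state set $\Sigma$ and neighbourhood $N$. It defines a non-uniform cellular automaton (NUCA) with global update rule $H_\theta:\Sigma^{\mathbb{Z}^d}\to\Sigma^{\mathbb{Z}^d}$, $$H_\theta(c)(\bar x) = \theta(\bar x)\big(c(\bar x+\bar n_1),\ldots,c(\bar x+\bar n_m)\big)\quad\text{for all } \bar x \in \mathbb{Z}^d.$$ Two configurations $c,e\in\Sigma^{\mathbb{Z}^d}$ are asymptotic if $\{\bar x : c(\bar x)\neq e(\bar x)\}$ is finite. $H_\theta$ is pre-injective if $H_\theta(c)\neq H_\theta(e)$ for all asymptotic $c,e$ with $c \neq e$. A hypercube of width $w \in \mathbb{Z}_+$ is a set $\{\bar x + (v_1,\ldots,v_d) : 0\le v_i < w \text{ for all } i\}$ with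 $\bar x\in\mathbb{Z}^d$. For finite $D \subseteq \mathbb{Z}^d$ and a configuration $c$, a translated copy of $c_{|D}$ is a pattern $p$ with domain $D+\bar r$, for some $\bar r\in\mathbb{Z}^d$, such that $p(\bar x+\bar r)=c(\bar x)$ for all $\bar x \in D$. A configuration $c$ is uniformly recurrent if for every finite $D\subseteq\mathbb{Z}^d$ there is $w\in\mathbb{Z}_+$ such that every hypercube $C$ of width $w$ contains a translated copy of $c_{|D}$, i.e. there is $\bar r$ with $D+\bar r\subseteq C$ and $c(\bar x+\bar r)=c(\bar x)$ for all $\bar x\in D$. *)

theory Defs
  imports "HOL-Analysis.Finite_Cartesian_Product" "HOL-Library.FuncSet"
begin

text \<open>
  Cells are the vectors of type \<open>int ^ 'd\<close>, where \<open>CARD('d)\<close> is the dimension, and a configuration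
  is a function on cells. The finite state set is a type of class \<open>finite\<close>. A neighbourhood is a
  list of vectors.
\<close>

text \<open>
  A tuple in \<open>\<Sigma>\<^sup>m\<close> is a list of length \<open>m\<close>. Local rules are extensional, so that two rules are
  equal exactly if they agree on all lists of length \<open>m\<close>. This matters because recurrence of a
  rule distribution refers to equality of rules.
\<close>

definition local_rules :: "(int ^ 'd::finite) list \<Rightarrow> ('s list \<Rightarrow> 's) set" where
  "local_rules N = {p. length p = length N} \<rightarrow>\<^sub>E UNIV"

definition global_update ::
    "(int ^ 'd::finite) list \<Rightarrow> (int ^ 'd \<Rightarrow> 's list \<Rightarrow> 's) \<Rightarrow> (int ^ 'd \<Rightarrow> 's) \<Rightarrow> (int ^ 'd \<Rightarrow> 's)" where
  "global_update N \<theta> c = (\<lambda>x. \<theta> x (map (\<lambda>n. c (x + n)) N))"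

definition asymptotic :: "(int ^ 'd::finite \<Rightarrow> 's) \<Rightarrow> (int ^ 'd \<Rightarrow> 's) \<Rightarrow> bool" where
  "asymptotic c e \<longleftrightarrow> finite {x. c x \<noteq> e x}"

definition pre_injective :: "((int ^ 'd::finite \<Rightarrow> 's) \<Rightarrow> (int ^ 'd \<Rightarrow> 's)) \<Rightarrow> bool" where
  "pre_injective H \<longleftrightarrow> (\<forall>c e. asymptotic c e \<longrightarrow> c \<noteq> e \<longrightarrow> H c \<noteq> H e)"

definition hypercube :: "int ^ 'd::finite \<Rightarrow> nat \<Rightarrow> (int ^ 'd) set" where
  "hypercube x w = {x + v | v. \<forall>i. 0 \<le> v $ i \<and> v $ i < int w}"

definition uniformly_recurrent :: "(int ^ 'd::finite \<Rightarrow> 'a) \<Rightarrow> bool" where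
  "uniformly_recurrent c \<longleftrightarrow>
    (\<forall>D. finite D \<longrightarrow>
      (\<exists>w>0. \<forall>y. \<exists>r. (\<lambda>x. x + r) ` D \<subseteq> hypercube y w \<and> (\<forall>x\<in>D. c (x + r) = c x)))"

end

(*
  Both implications are counted on a cube of k^d blocks of width w, where s is the number of states.
  If H is not surjective, then by compactness some finite pattern has no preimage, and recurrence
  of the rule distribution puts a translate of it in every block. So H maps the s^|I|
  configurations supported on a slightly smaller cube I to at most (s^(w^d) - 1)^(k^d) patterns.
  If c and e witness the failure of pre-injectivity, every copy of e in a block whose rules match
  can be replaced by c without changing the image, so (s^(w^d) - 1)^(k^d) patterns suffice to
  produce all images on I. In both cases s^|I| is too large when k is large.
*)

theory Submission
  imports Defs "HOL-Analysis.Function_Topology"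
begin

section \<open>Hypercubes and locality of the global update\<close>

lemma mem_hypercube_iff:
  "x \<in> hypercube y w \<longleftrightarrow> (\<forall>i. y $ i \<le> x $ i \<and> x $ i < y $ i + int w)"
proof
  assume "\<forall>i. y $ i \<le> x $ i \<and> x $ i < y $ i + int w"
  then have "x = y + (x - y) \<and> (\<forall>i. 0 \<le> (x - y) $ i \<and> (x - y) $ i < int w)"
    by (auto simp: algebra_simps)
  then show "x \<in> hypercube y w"
    unfolding hypercube_def by blast
qed (auto simp: hypercube_def)

lemma bij_betw_vec_nth_hypercube:
  "bij_betw vec_nth (hypercube y w) (\<Pi>\<^sub>E i\<in>UNIV. {y $ i..<y $ i + int w})"
proof (rule bij_betwI[where g = vec_lambda])
  show "vec_nth \<in> hypercube y w \<rightarrow> (\<Pi>\<^sub>E i\<in>UNIV. {y $ i..<y $ i + int w})"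
    by (auto simp: mem_hypercube_iff)
  show "vec_lambda \<in> (\<Pi>\<^sub>E i\<in>UNIV. {y $ i..<y $ i + int w}) \<rightarrow> hypercube y w"
    by (auto simp: mem_hypercube_iff PiE_iff)
qed auto

lemma finite_hypercube: "finite (hypercube (y :: int ^ 'd::finite) w)"
  using bij_betw_finite[OF bij_betw_vec_nth_hypercube] by (metis finite_PiE finite finite_atLeastLessThan_int)

lemma card_hypercube: "card (hypercube (y :: int ^ 'd::finite) w) = w ^ CARD('d)"
  using bij_betw_same_card[OF bij_betw_vec_nth_hypercube[of y w]] by (simp add: card_PiE)

lemma global_update_cong:
  assumes "\<And>n. n \<in> set N \<Longrightarrow> c (x + n) = e (x + n)"
  shows "global_update N \<theta> c x = global_update N \<theta> e x"
  unfolding global_update_def using assms by (metis map_cong)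

lemma global_update_translate:
  assumes "\<theta> (x + t) = \<theta> x"
  shows "global_update N \<theta> c (x + t) = global_update N \<theta> (\<lambda>y. c (y + t)) x"
  using assms by (simp add: global_update_def algebra_simps)

section \<open>Compactness\<close>

text \<open>The configurations whose image has the prescribed value at one cell form a closed set in
  a product of finite discrete spaces, which is compact by Tychonoff. The hypothesis is the finite
  intersection property of these sets.\<close>

lemma ex_global_update_eq:
  fixes N :: "(int ^ 'd::finite) list" and \<theta> :: "int ^ 'd \<Rightarrow> 's::finite list \<Rightarrow> 's"
  assumes "\<And>D. finite D \<Longrightarrow> \<exists>c. \<forall>x\<in>D. global_update N \<theta> c x = y x"
  shows "\<exists>c. global_update N \<theta> c = y"
proof -
  define X where "X = product_topology (\<lambda>_ :: int ^ 'd. discrete_topology (UNIV :: 's set)) UNIV"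
  define K where "K x = {c. global_update N \<theta> c x = y x}" for x
  have top: "topspace X = UNIV"
    by (simp add: X_def)
  have compact: "compact_space X"
    unfolding X_def by (simp add: compact_space_product_topology compact_space_discrete_topology)
  have cyl: "closedin X {c. c u = a}" for u a
  proof -
    have "closedin X {c \<in> topspace X. c u \<in> {a}}"
      by (rule closedin_continuous_map_preimage[of X "discrete_topology UNIV" "\<lambda>c. c u" "{a}"])
        (auto simp: X_def intro: continuous_map_product_projection[of u UNIV "\<lambda>_. discrete_topology UNIV"])
    then show ?thesis
      by (simp add: top)
  qed
  have closed: "closedin X (K x)" for x
  proof -
    \<comment> \<open>\<open>L\<close> holds the tuples that the rule at \<open>x\<close> sends to
      \<open>y x\<close>. There are finitely many of them, so \<open>K x\<close> is a finite union
      of cylinders.\<close>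
    define L where "L = {l. set l \<subseteq> UNIV \<and> length l = length N} \<inter> {l. \<theta> x l = y x}"
    have "finite L"
      unfolding L_def by (intro finite_Int disjI1 finite_lists_length_eq) simp
    moreover have "closedin X (topspace X \<inter> (\<Inter>i\<in>{..<length N}. {c. c (x + N ! i) = l ! i}))" for l
      by (cases "N = []") (auto intro!: closedin_Int closedin_INT cyl)
    moreover have "K x = (\<Union>l\<in>L. topspace X \<inter> (\<Inter>i\<in>{..<length N}. {c. c (x + N ! i) = l ! i}))"
    proof (intro set_eqI iffI)
      fix c assume "c \<in> K x"
      then have "map (\<lambda>n. c (x + n)) N \<in> L"
        by (simp add: K_def L_def global_update_def)
      then show "c \<in> (\<Union>l\<in>L. topspace X \<inter> (\<Inter>i\<in>{..<length N}. {c. c (x + N ! i) = l ! i}))"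
        by (rule UN_I) (auto simp: top)
    next
      fix c assume "c \<in> (\<Union>l\<in>L. topspace X \<inter> (\<Inter>i\<in>{..<length N}. {c. c (x + N ! i) = l ! i}))"
      then obtain l where l: "l \<in> L" "\<And>i. i < length N \<Longrightarrow> c (x + N ! i) = l ! i"
        by auto
      then have "map (\<lambda>n. c (x + n)) N = l"
        by (auto simp: L_def intro: nth_equalityI)
      with l(1) show "c \<in> K x"
        by (simp add: K_def L_def global_update_def)
    qed
    ultimately show ?thesis
      by (metis (no_types, lifting) closedin_Union finite_imageI imageE)
  qed
  have "\<Inter>(range K) \<noteq> {}"
  proof (rule compact_space_fip[THEN iffD1, rule_format, OF compact])
    show "(\<forall>C\<in>range K. closedin X C) \<and> (\<forall>F. finite F \<and> F \<subseteq> range K \<longrightarrow> \<Inter>F \<noteq> {})"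
    proof (intro conjI allI impI)
      fix F assume "finite F \<and> F \<subseteq> range K"
      then obtain D where "finite D" "F = K ` D"
        by (meson finite_subset_image)
      then show "\<Inter>F \<noteq> {}"
        using assms[of D] by (auto simp: K_def)
    qed (use closed in auto)
  qed
  then show ?thesis
    by (auto simp: K_def)
qed

section \<open>Boundary against volume\<close>

text \<open>After taking logarithms and dividing by \<open>k ^ d\<close>, the two sides are
  \<open>ln (s ^ w ^ d - 1)\<close> and \<open>(w - 2 * r / k) ^ d * ln s\<close>. The latter tends
  to \<open>ln (s ^ w ^ d)\<close>, which exceeds the former, so every large \<open>k\<close>
  works.\<close>

lemma ex_scale_power_less:
  fixes s w r d :: nat
  assumes "s > 0" "w > 0"
  shows "\<exists>k. 2 * r \<le> k * w \<and> (s ^ w ^ d - 1) ^ k ^ d < s ^ (k * w - 2 * r) ^ d"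
proof (cases "s ^ w ^ d = 1")
  \<comment> \<open>Here \<open>s = 1\<close>, so the base is 0 and logarithms do not help. A
    successor as \<open>k\<close> makes the exponent positive and the left-hand side 0.\<close>
  case True
  have "2 * r \<le> Suc (2 * r) * w"
    using assms(2) by (cases w) auto
  moreover have "s ^ w ^ d - 1 = 0"
    using True by linarith
  ultimately show ?thesis
    using assms(1) by (intro exI[of _ "Suc (2 * r)"]) (simp only: zero_power zero_less_power zero_less_Suc)
next
  case False
  define a where "a = s ^ w ^ d - 1"
  have "s ^ w ^ d > 0"
    using assms(1) by simp
  then have "a > 0" "a < s ^ w ^ d"
    unfolding a_def using False by linarith+
  then have a: "a > 0" "real a < real s ^ w ^ d"
    by (auto simp flip: of_nat_power)
  have "(\<lambda>k. (real w - real (2 * r) / real k) ^ d * ln (real s)) \<longlonglongrightarrow> (real w - 0) ^ d * ln (real s)"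
    by (intro tendsto_intros lim_const_over_n)
  moreover have "ln (real a) < (real w - 0) ^ d * ln (real s)"
  proof -
    have "ln (real a) < ln (real s ^ w ^ d)"
      using a assms(1) by (subst ln_less_cancel_iff) auto
    then show ?thesis
      using assms(1) by (simp add: ln_realpow)
  qed
  ultimately have "\<forall>\<^sub>F k in sequentially. ln (real a) < (real w - real (2 * r) / real k) ^ d * ln (real s)"
    by (rule order_tendstoD)
  moreover have "\<forall>\<^sub>F k in sequentially. k > 2 * r"
    by (rule eventually_gt_at_top)
  ultimately have "\<forall>\<^sub>F k in sequentially. k > 2 * r \<and>
      ln (real a) < (real w - real (2 * r) / real k) ^ d * ln (real s)"
    by (rule eventually_conj[rotated])
  then obtain k where k: "k > 2 * r"
      "ln (real a) < (real w - real (2 * r) / real k) ^ d * ln (real s)"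
    using eventually_happens by force
  have le: "2 * r \<le> k * w"
    using k(1) assms(2) by (cases w) auto
  have "ln (real (a ^ k ^ d)) = real k ^ d * ln (real a)"
    using a by (simp add: ln_realpow)
  also have "\<dots> < real k ^ d * ((real w - real (2 * r) / real k) ^ d * ln (real s))"
    using k by (intro mult_strict_left_mono) auto
  also have "\<dots> = (real k * (real w - real (2 * r) / real k)) ^ d * ln (real s)"
    by (simp add: power_mult_distrib)
  also have "real k * (real w - real (2 * r) / real k) = real (k * w - 2 * r)"
    using k(1) le by (simp add: of_nat_diff right_diff_distrib)
  also have "real (k * w - 2 * r) ^ d * ln (real s) = ln (real (s ^ (k * w - 2 * r) ^ d))"
    using assms(1) by (simp add: ln_realpow)
  finally have "a ^ k ^ d < s ^ (k * w - 2 * r) ^ d"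
    using a(1) assms(1) by (subst (asm) ln_less_cancel_iff) (auto simp flip: of_nat_power)
  with le show ?thesis
    unfolding a_def by blast
qed

section \<open>Tiling by blocks, and counting with one forbidden pattern per block\<close>

text \<open>Aligning the cubes to multiples of \<open>w\<close> makes them a tiling, so changes made
  in different blocks do not interfere.\<close>

definition block :: "nat \<Rightarrow> int ^ 'd::finite \<Rightarrow> (int ^ 'd) set" where
  "block w j = hypercube (\<chi> i. int w * j $ i) w"

definition block_index :: "nat \<Rightarrow> int ^ 'd::finite \<Rightarrow> int ^ 'd" where
  "block_index w x = (\<chi> i. x $ i div int w)"

lemma mem_block_iff:
  assumes "w > 0"
  shows "x \<in> block w j \<longleftrightarrow> block_index w x = j"
proof -
  have "int w > 0"
    using assms by simp
  then have "int w * b \<le> a \<and> a < int w * b + int w \<longleftrightarrow> a div int w = b" for a b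
  proof (intro iffI)
    assume "int w * b \<le> a \<and> a < int w * b + int w"
    then show "a div int w = b"
      by (intro int_div_pos_eq[of a "int w" b "a - int w * b"]) auto
  next
    assume b: "a div int w = b"
    show "int w * b \<le> a \<and> a < int w * b + int w"
      unfolding b[symmetric] using \<open>int w > 0\<close> pos_mod_bound[of "int w" a]
        pos_mod_sign[of "int w" a] mult_div_mod_eq[of "int w" a] by linarith
  qed
  then show ?thesis
    by (simp add: block_def block_index_def mem_hypercube_iff vec_eq_iff)
qed

text \<open>This makes the large cube the disjoint union of the \<open>k ^ CARD('d)\<close> blocks
  with index in \<open>hypercube 0 k\<close>; its boundary cuts no block.\<close>

lemma block_index_mem_hypercube:
  assumes "w > 0"
  shows "block_index w x \<in> hypercube 0 k \<longleftrightarrow> x \<in> hypercube 0 (k * w)"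
proof -
  have "0 \<le> a div int w \<and> a div int w < int k \<longleftrightarrow> 0 \<le> a \<and> a < int (k * w)" for a
  proof (cases "0 \<le> a")
    case True
    then obtain n where "a = int n"
      by (metis nonneg_int_cases)
    then show ?thesis
      using assms by (simp add: div_less_iff_less_mult flip: zdiv_int of_nat_mult)
  next
    case False
    then show ?thesis
      using assms by (simp add: pos_imp_zdiv_nonneg_iff)
  qed
  then show ?thesis
    by (simp add: mem_hypercube_iff block_index_def)
qed

text \<open>Cutting a pattern on the large cube into blocks is injective, and each block loses one
  of its \<open>CARD('s) ^ w ^ CARD('d)\<close> patterns. Since \<open>P\<close> depends on
  \<open>j\<close>, the forbidden pattern may sit at a different place in each block.\<close>

lemma card_block_avoiding_le:
  fixes P :: "int ^ 'd::finite \<Rightarrow> int ^ 'd \<Rightarrow> 's::finite" and w k :: nat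
  assumes "w > 0"
  defines "Q \<equiv> hypercube (0 :: int ^ 'd) (k * w)" and "J \<equiv> hypercube (0 :: int ^ 'd) k"
  shows "card {z \<in> Q \<rightarrow>\<^sub>E UNIV. \<forall>j\<in>J. \<exists>x\<in>block w j. z x \<noteq> P j x}
    \<le> (CARD('s) ^ w ^ CARD('d) - 1) ^ k ^ CARD('d)" (is "card ?A \<le> _")
proof -
  define B where "B j = (block w j \<rightarrow>\<^sub>E (UNIV :: 's set)) - {restrict (P j) (block w j)}" for j
  have fin: "finite (block w j)" for j :: "int ^ 'd"
    by (simp add: block_def finite_hypercube)
  have "card (B j) = CARD('s) ^ w ^ CARD('d) - 1" for j
    by (simp add: B_def card_Diff_singleton card_PiE fin) (simp add: block_def card_hypercube)
  then have card: "card (PiE J B) = (CARD('s) ^ w ^ CARD('d) - 1) ^ k ^ CARD('d)"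
    by (simp add: card_PiE J_def finite_hypercube card_hypercube)
  define F where "F z = (\<lambda>j\<in>J. restrict z (block w j))" for z :: "int ^ 'd \<Rightarrow> 's"
  have "inj_on F ?A"
  proof (rule inj_onI)
    fix z z' assume *: "z \<in> ?A" "z' \<in> ?A" "F z = F z'"
    show "z = z'"
    proof (rule PiE_ext[of z Q "\<lambda>_. UNIV"])
      fix x assume "x \<in> Q"
      then have "block_index w x \<in> J"
        using assms by (simp add: block_index_mem_hypercube)
      with *(3) have "restrict z (block w (block_index w x)) = restrict z' (block w (block_index w x))"
        by (metis F_def restrict_apply')
      then show "z x = z' x"
        by (metis mem_block_iff[OF assms(1)] restrict_apply')
    qed (use * in auto)
  qed
  moreover have "F ` ?A \<subseteq> PiE J B"
  proof (intro image_subsetI PiE_I)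
    fix z j assume "z \<in> ?A" "j \<in> J"
    then obtain x where "x \<in> block w j" "z x \<noteq> P j x"
      by blast
    then have "restrict z (block w j) \<noteq> restrict (P j) (block w j)"
      by (metis restrict_apply')
    then show "F z j \<in> B j"
      using \<open>j \<in> J\<close> by (simp add: F_def B_def)
  qed (simp add: F_def)
  moreover have "finite (PiE J B)"
    unfolding J_def by (intro finite_PiE) (auto simp: B_def finite_hypercube finite_PiE fin)
  ultimately show ?thesis
    unfolding card[symmetric] by (rule card_inj_on_le)
qed

text \<open>
  The inner cube loses only a boundary layer, which for large \<open>k\<close> weighs less than the factor
  that each block loses by avoiding a pattern.
\<close>

lemma ex_block_avoiding_less:
  fixes N :: "(int ^ 'd::finite) list"
  assumes "w > 0"
  obtains k and I :: "(int ^ 'd) set" where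
    "finite I" "\<And>x n. n \<in> set N \<Longrightarrow> x \<in> I \<Longrightarrow> x + n \<in> hypercube 0 (k * w)"
    "\<And>x n. n \<in> set N \<Longrightarrow> x + n \<in> I \<Longrightarrow> x \<in> hypercube 0 (k * w)"
    "\<And>P :: int ^ 'd \<Rightarrow> int ^ 'd \<Rightarrow> 's::finite.
      card {z \<in> hypercube 0 (k * w) \<rightarrow>\<^sub>E UNIV. \<forall>j\<in>hypercube 0 k. \<exists>x\<in>block w j. z x \<noteq> P j x}
        < card (I \<rightarrow>\<^sub>E (UNIV :: 's set))"
proof -
  \<comment> \<open>A crude bound on all coordinates of neighbourhood vectors; a sum, unlike a
    maximum, also has a value for empty \<open>N\<close>.\<close>
  define r where "r = (\<Sum>n\<in>set N. \<Sum>i\<in>UNIV. nat \<bar>n $ i\<bar>)"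
  have r: "\<bar>n $ i\<bar> \<le> int r" if "n \<in> set N" for n i
  proof -
    have "nat \<bar>n $ i\<bar> \<le> (\<Sum>i\<in>UNIV. nat \<bar>n $ i\<bar>)"
      by (rule member_le_sum) auto
    also have "\<dots> \<le> r"
      unfolding r_def by (rule member_le_sum[OF that]) auto
    finally show ?thesis
      by simp
  qed
  obtain k where k: "2 * r \<le> k * w"
      "(CARD('s) ^ w ^ CARD('d) - 1) ^ k ^ CARD('d) < CARD('s) ^ (k * w - 2 * r) ^ CARD('d)"
    using ex_scale_power_less[of "CARD('s)" w r] assms by auto
  \<comment> \<open>The large cube shrunk by \<open>r\<close> on every side. Cells of
    \<open>I\<close> see only the large cube, as needed to derive pre-injectivity, and only cells of
    the large cube see \<open>I\<close>, as needed to derive surjectivity.\<close>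
  define I where "I = hypercube (\<chi> i :: 'd. int r) (k * w - 2 * r)"
  have I: "x \<in> I \<longleftrightarrow> (\<forall>i. int r \<le> x $ i \<and> x $ i < int (k * w) - int r)" for x
    using k(1) by (simp add: I_def mem_hypercube_iff of_nat_diff)
  show ?thesis
  proof (rule that[of I k])
    show "finite I"
      by (simp add: I_def finite_hypercube)
    show "x + n \<in> hypercube 0 (k * w)" if "n \<in> set N" "x \<in> I" for x n
      unfolding mem_hypercube_iff
    proof
      fix i
      show "0 $ i \<le> (x + n) $ i \<and> (x + n) $ i < 0 $ i + int (k * w)"
        using r[OF that(1), of i] that(2)[unfolded I, rule_format, of i] unfolding vector_add_component zero_index by linarith
    qed
    show "x \<in> hypercube 0 (k * w)" if "n \<in> set N" "x + n \<in> I" for x n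
      unfolding mem_hypercube_iff
    proof
      fix i
      show "0 $ i \<le> x $ i \<and> x $ i < 0 $ i + int (k * w)"
        using r[OF that(1), of i] that(2)[unfolded I, rule_format, of i] unfolding vector_add_component zero_index by linarith
    qed
    have "card (I \<rightarrow>\<^sub>E (UNIV :: 's set)) = CARD('s) ^ (k * w - 2 * r) ^ CARD('d)"
      by (simp add: I_def card_PiE finite_hypercube card_hypercube)
    then show "card {z \<in> hypercube 0 (k * w) \<rightarrow>\<^sub>E UNIV. \<forall>j\<in>hypercube 0 k. \<exists>x\<in>block w j. z x \<noteq> P j x}
        < card (I \<rightarrow>\<^sub>E (UNIV :: 's set))" for P :: "int ^ 'd \<Rightarrow> int ^ 'd \<Rightarrow> 's"
      using card_block_avoiding_le[OF assms, of k P] k(2) by linarith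
  qed
qed

section \<open>Recurrence and the two implications\<close>

lemma uniformly_recurrent_blocks:
  assumes "uniformly_recurrent \<theta>" "finite D"
  obtains w t where "w > 0" "\<And>j x. x \<in> D \<Longrightarrow> x + t j \<in> block w j"
    "\<And>j x. x \<in> D \<Longrightarrow> \<theta> (x + t j) = \<theta> x"
proof -
  obtain w where w: "w > 0"
      "\<forall>y. \<exists>r. (\<lambda>x. x + r) ` D \<subseteq> hypercube y w \<and> (\<forall>x\<in>D. \<theta> (x + r) = \<theta> x)"
    using assms unfolding uniformly_recurrent_def by meson
  then have "\<forall>j. \<exists>r. (\<lambda>x. x + r) ` D \<subseteq> block w j \<and> (\<forall>x\<in>D. \<theta> (x + r) = \<theta> x)"
    by (simp add: block_def)
  then obtain t where "\<forall>j. (\<lambda>x. x + t j) ` D \<subseteq> block w j \<and> (\<forall>x\<in>D. \<theta> (x + t j) = \<theta> x)"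
    by metis
  with w(1) show ?thesis
    by (intro that[of w t]) auto
qed

lemma pre_injective_imp_surj:
  fixes N :: "(int ^ 'd::finite) list" and \<theta> :: "int ^ 'd \<Rightarrow> 's::finite list \<Rightarrow> 's"
  assumes "uniformly_recurrent \<theta>" "pre_injective (global_update N \<theta>)"
  shows "surj (global_update N \<theta>)"
proof (rule ccontr)
  let ?H = "global_update N \<theta>"
  assume "\<not> surj ?H"
  then obtain y where y: "\<nexists>c. ?H c = y"
    unfolding surj_def by metis
  \<comment> \<open>By compactness, having no preimage already shows on a finite set
    \<open>D\<close>: the restriction of \<open>y\<close> to \<open>D\<close> is an orphan.\<close>
  have "\<not> (\<forall>D. finite D \<longrightarrow> (\<exists>c. \<forall>x\<in>D. ?H c x = y x))"
    by (rule notI, rule notE[OF y], rule ex_global_update_eq) simp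
  then obtain D where D: "finite D" "\<And>c. \<exists>x\<in>D. ?H c x \<noteq> y x"
    by auto
  obtain w t where wt: "w > 0" "\<And>j x. x \<in> D \<Longrightarrow> x + t j \<in> block w j"
    "\<And>j x. x \<in> D \<Longrightarrow> \<theta> (x + t j) = \<theta> x"
    using uniformly_recurrent_blocks[OF assms(1) D(1)] by metis
  obtain k and I :: "(int ^ 'd) set" where I: "finite I"
    "\<And>x n. n \<in> set N \<Longrightarrow> x + n \<in> I \<Longrightarrow> x \<in> hypercube 0 (k * w)"
    "\<And>P :: int ^ 'd \<Rightarrow> int ^ 'd \<Rightarrow> 's.
      card {z \<in> hypercube 0 (k * w) \<rightarrow>\<^sub>E UNIV. \<forall>j\<in>hypercube 0 k. \<exists>x\<in>block w j. z x \<noteq> P j x}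
        < card (I \<rightarrow>\<^sub>E (UNIV :: 's set))"
    using ex_block_avoiding_less[OF wt(1), of N thesis] by blast
  define Q where "Q = hypercube (0 :: int ^ 'd) (k * w)"
  \<comment> \<open>The orphan moved into block \<open>j\<close>; the rest of the shifted
    \<open>y\<close> fills the block, so that one full block pattern is forbidden.\<close>
  define P where "P j x = y (x - t j)" for j x
  let ?A = "{z \<in> Q \<rightarrow>\<^sub>E UNIV. \<forall>j\<in>hypercube 0 k. \<exists>x\<in>block w j. z x \<noteq> P j x}"
  let ?F = "\<lambda>c. restrict (?H c) Q"
  have "inj_on ?F (I \<rightarrow>\<^sub>E UNIV)"
  proof (rule inj_onI)
    fix c e :: "int ^ 'd \<Rightarrow> 's"
    assume *: "c \<in> I \<rightarrow>\<^sub>E UNIV" "e \<in> I \<rightarrow>\<^sub>E UNIV" "?F c = ?F e"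
    \<comment> \<open>Members of \<open>I \<rightarrow>\<^sub>E UNIV\<close> are
      \<open>undefined\<close> outside \<open>I\<close>. This value is a common background state,
      which makes them asymptotic.\<close>
    have out: "c x = e x" if "x \<notin> I" for x
      using * that by (simp add: PiE_iff extensional_def)
    have "?H c x = ?H e x" for x
    proof (cases "x \<in> Q")
      case True
      then show ?thesis
        using *(3) by (metis restrict_apply')
    next
      \<comment> \<open>A cell outside \<open>Q\<close> has no neighbour in \<open>I\<close>, so
        equality of the images on \<open>Q\<close> extends to all cells.\<close>
      case False
      then show ?thesis
        using I(2) out by (intro global_update_cong) (auto simp: Q_def)
    qed
    moreover have "asymptotic c e"
      unfolding asymptotic_def using out by (intro finite_subset[OF _ I(1)]) auto
    ultimately show "c = e"
      using assms(2) unfolding pre_injective_def by blast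
  qed
  moreover have "?F ` (I \<rightarrow>\<^sub>E UNIV) \<subseteq> ?A"
  proof clarify
    fix c :: "int ^ 'd \<Rightarrow> 's"
    have "\<exists>x\<in>block w j. ?F c x \<noteq> P j x" if "j \<in> hypercube 0 k" for j
    proof -
      obtain x where x: "x \<in> D" "?H (\<lambda>u. c (u + t j)) x \<noteq> y x"
        using D(2) by blast
      have "x + t j \<in> Q"
        using wt(2)[OF x(1), of j] that wt(1)
        by (metis Q_def mem_block_iff block_index_mem_hypercube)
      then show ?thesis
        using x wt(2)[OF x(1), of j] global_update_translate[of \<theta> x "t j" N c, OF wt(3)[OF x(1)]]
        by (intro bexI[of _ "x + t j"]) (auto simp: P_def)
    qed
    then show "?F c \<in> Q \<rightarrow>\<^sub>E UNIV \<and> (\<forall>j\<in>hypercube 0 k. \<exists>x\<in>block w j. ?F c x \<noteq> P j x)"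
      by auto
  qed
  moreover have "finite ?A"
    by (rule finite_subset[of _ "Q \<rightarrow>\<^sub>E UNIV"]) (auto simp: Q_def finite_hypercube intro!: finite_PiE)
  ultimately have "card (I \<rightarrow>\<^sub>E (UNIV :: 's set)) \<le> card ?A"
    by (rule card_inj_on_le)
  with I(3)[of P] show False
    by (simp add: Q_def)
qed

lemma surj_imp_pre_injective:
  fixes N :: "(int ^ 'd::finite) list" and \<theta> :: "int ^ 'd \<Rightarrow> 's::finite list \<Rightarrow> 's"
  assumes "uniformly_recurrent \<theta>" "surj (global_update N \<theta>)"
  shows "pre_injective (global_update N \<theta>)"
proof (rule ccontr)
  let ?H = "global_update N \<theta>"
  assume "\<not> pre_injective ?H"
  then obtain c e where ce: "asymptotic c e" "c \<noteq> e" "?H c = ?H e"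
    unfolding pre_injective_def by blast
  define D where "D = {x. c x \<noteq> e x}"
  \<comment> \<open>\<open>D1\<close> collects the cells that see a difference of \<open>c\<close>
    and \<open>e\<close>, and \<open>D2\<close> adds all that these cells see. With
    \<open>D2\<close> translated into a block, a cell that sees a replaced value there sees only
    that block, and its rule matches.\<close>
  define D1 where "D1 = (\<Union>n\<in>set N. (\<lambda>x. x - n) ` D)"
  define D2 where "D2 = D \<union> D1 \<union> (\<Union>n\<in>set N. (\<lambda>x. x + n) ` D1)"
  have "finite D"
    using ce(1) by (simp add: D_def asymptotic_def)
  then have "finite D2"
    by (auto simp: D1_def D2_def)
  obtain w t where wt: "w > 0" "\<And>j x. x \<in> D2 \<Longrightarrow> x + t j \<in> block w j"
    "\<And>j x. x \<in> D2 \<Longrightarrow> \<theta> (x + t j) = \<theta> x"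
    using uniformly_recurrent_blocks[OF assms(1) \<open>finite D2\<close>] by metis
  obtain k and I :: "(int ^ 'd) set" where I: "finite I"
    "\<And>x n. n \<in> set N \<Longrightarrow> x \<in> I \<Longrightarrow> x + n \<in> hypercube 0 (k * w)"
    "\<And>P :: int ^ 'd \<Rightarrow> int ^ 'd \<Rightarrow> 's.
      card {z \<in> hypercube 0 (k * w) \<rightarrow>\<^sub>E UNIV. \<forall>j\<in>hypercube 0 k. \<exists>x\<in>block w j. z x \<noteq> P j x}
        < card (I \<rightarrow>\<^sub>E (UNIV :: 's set))"
    using ex_block_avoiding_less[OF wt(1), of N thesis] by blast
  define Q where "Q = hypercube (0 :: int ^ 'd) (k * w)"
  define P where "P j x = e (x - t j)" for j x
  \<comment> \<open>All blocks are treated at once: one filled exactly by the shifted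
    \<open>e\<close> receives the shifted \<open>c\<close>. Values change only on the translate of
    \<open>D\<close>.\<close>
  define erase where "erase z x = (let j = block_index w x in
      if \<forall>u\<in>block w j. z u = P j u then c (x - t j) else z x)" for z x
  let ?A = "{z \<in> Q \<rightarrow>\<^sub>E UNIV. \<forall>j\<in>hypercube 0 k. \<exists>x\<in>block w j. z x \<noteq> P j x}"
  have erase_block: "erase z x = (if \<forall>u\<in>block w j. z u = P j u then c (x - t j) else z x)"
    if "x \<in> block w j" for z x j
    using that wt(1) by (simp add: erase_def mem_block_iff)
  \<comment> \<open>A cell that sees a change lies in the translate of \<open>D1\<close>, so its
    whole neighbourhood is in block \<open>j\<close>. There \<open>z\<close> is the shifted
    \<open>e\<close> and \<open>erase z\<close> the shifted \<open>c\<close>, and \<open>c\<close>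
    and \<open>e\<close> have equal images.\<close>
  have H_erase: "?H (erase z) x = ?H z x" for z x
  proof (cases "\<exists>n\<in>set N. erase z (x + n) \<noteq> z (x + n)")
    case True
    then obtain n where n: "n \<in> set N" "erase z (x + n) \<noteq> z (x + n)"
      by blast
    define j where "j = block_index w (x + n)"
    have "x + n \<in> block w j"
      using wt(1) by (simp add: j_def mem_block_iff)
    then have z: "\<forall>u\<in>block w j. z u = P j u" and "c (x + n - t j) \<noteq> e (x + n - t j)"
      using n(2) by (auto simp: erase_block P_def split: if_splits)
    then have "x + n - t j \<in> D"
      by (simp add: D_def)
    then have "x + n - t j - n \<in> D1"
      unfolding D1_def using n(1) by blast
    then have x: "x - t j \<in> D1"
      by simp
    then have nb: "x - t j + m \<in> D2" if "m \<in> set N" for m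
      unfolding D2_def using that by blast
    have nb': "x + m \<in> block w j" if "m \<in> set N" for m
      using wt(2)[OF nb[OF that], of j] by (simp add: algebra_simps)
    have \<theta>: "\<theta> (x - t j + t j) = \<theta> (x - t j)"
      using x by (intro wt(3)) (simp add: D2_def)
    have "?H (erase z) x = ?H (\<lambda>u. erase z (u + t j)) (x - t j)"
      using global_update_translate[of \<theta>, OF \<theta>, of N "erase z"] by simp
    also have "\<dots> = ?H c (x - t j)"
    proof (rule global_update_cong)
      fix m assume "m \<in> set N"
      then show "erase z (x - t j + m + t j) = c (x - t j + m)"
        using z erase_block[OF nb', of m z] by (simp add: algebra_simps)
    qed
    also have "\<dots> = ?H e (x - t j)"
      by (simp add: ce(3))
    also have "\<dots> = ?H (\<lambda>u. z (u + t j)) (x - t j)"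
      using nb' z by (intro global_update_cong) (simp add: P_def algebra_simps)
    also have "\<dots> = ?H z x"
      using global_update_translate[of \<theta>, OF \<theta>, of N z] by simp
    finally show ?thesis .
  next
    case False
    then show ?thesis
      by (intro global_update_cong) auto
  qed
  \<comment> \<open>A replaced block now differs from the shifted \<open>e\<close> on the translate
    of \<open>D\<close>; any other block differed before and is unchanged.\<close>
  have erase_avoids: "\<exists>x\<in>block w j. erase z x \<noteq> P j x" for z j
  proof (cases "\<forall>u\<in>block w j. z u = P j u")
    case True
    obtain x where x: "c x \<noteq> e x"
      using ce(2) by blast
    then have "x + t j \<in> block w j"
      by (intro wt(2)) (simp add: D_def D2_def)
    then show ?thesis
      using True x by (intro bexI[of _ "x + t j"]) (auto simp: erase_block P_def)
  next
    case False
    then show ?thesis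
      by (metis erase_block)
  qed
  have "I \<rightarrow>\<^sub>E UNIV \<subseteq> (\<lambda>z. restrict (?H z) I) ` ?A"
  proof
    fix p :: "int ^ 'd \<Rightarrow> 's"
    assume p: "p \<in> I \<rightarrow>\<^sub>E UNIV"
    \<comment> \<open>Being \<open>undefined\<close> outside \<open>I\<close>, the pattern
      \<open>p\<close> is itself a configuration, so surjectivity applies to it.\<close>
    obtain z where z: "p = ?H z"
      using assms(2) by (metis surjD)
    \<comment> \<open>Cutting off outside \<open>Q\<close> keeps the image on \<open>I\<close>,
      whose cells see only \<open>Q\<close>, and leaves finitely many candidates.\<close>
    define z' where "z' = restrict (erase z) Q"
    have "?H z' x = p x" if "x \<in> I" for x
    proof -
      have "?H z' x = ?H (erase z) x"
        using I(2)[OF _ that] by (intro global_update_cong) (simp add: z'_def Q_def)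
      then show ?thesis
        by (simp add: z H_erase)
    qed
    then have "p = restrict (?H z') I"
      using p by (intro ext) (auto simp: PiE_iff extensional_def)
    moreover have "z' \<in> ?A"
    proof -
      have "\<exists>x\<in>block w j. z' x \<noteq> P j x" if "j \<in> hypercube 0 k" for j
      proof -
        obtain x where x: "x \<in> block w j" "erase z x \<noteq> P j x"
          using erase_avoids by blast
        then have "x \<in> Q"
          using that wt(1) by (metis Q_def mem_block_iff block_index_mem_hypercube)
        with x show ?thesis
          by (auto simp: z'_def)
      qed
      then show ?thesis
        by (auto simp: z'_def)
    qed
    ultimately show "p \<in> (\<lambda>z. restrict (?H z) I) ` ?A"
      by blast
  qed
  moreover have "finite ?A"
    by (rule finite_subset[of _ "Q \<rightarrow>\<^sub>E UNIV"]) (auto simp: Q_def finite_hypercube intro!: finite_PiE)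
  ultimately have "card (I \<rightarrow>\<^sub>E (UNIV :: 's set)) \<le> card ?A"
    by (rule surj_card_le[rotated])
  with I(3)[of P] show False
    by (simp add: Q_def)
qed

theorem theorem1:
  fixes N :: "(int ^ 'd::finite) list"
    and R :: "('s::finite list \<Rightarrow> 's) set"
    and \<theta> :: "int ^ 'd \<Rightarrow> 's list \<Rightarrow> 's"
  assumes "finite R"
    and "R \<subseteq> local_rules N"
    and "\<And>x. \<theta> x \<in> R"
    and "uniformly_recurrent \<theta>"
  shows "surj (global_update N \<theta>) \<longleftrightarrow> pre_injective (global_update N \<theta>)"
  using assms(4) pre_injective_imp_surj surj_imp_pre_injective by blast

end
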